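(* Let $n\ge 1$ and $\lambda\in[1/(n+1),1/2]$. If $P\in\mathrm{VG}(\mathbb{R}^n,\lambda)$ has non-empty interior, then it has at least $1/(1-\lambda)^n$ vertices. Moreover, if $P\in\mathrm{VG}(\mathbb{R}^n)$ has exactly $2^n$ vertices, then it must be a linear image of the cube.
   Context: $V(P)$ denotes the set of vertices of a polytope $P\subset\mathbb{R}^n$; $A+B=\{a+b: a\in A,b\in B\}$ is the Minkowski sum. For a polytope $P\subset\mathbb{R}^n$ let $\lambda(P)=\sup\{\lambda: P=(1-\lambda)P+\lambda V(P)\}$. $P$ is called $\lambda$-vertex generated if $\lambda(P)\ge\lambda$, and $\mathrm{VG}(\mathbb{R}^n,\lambda)$ is the class of $\lambda$-vertex generated polytopes in $\mathbb{R}^n$. Also $\mathrm{VG}(\mathbb{R}^n)=\mathrm{VG}(\mathbb{R}^n,1/2)$, the class of polytopes with $P+V(P)=2P$.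
   Formalization: In the "Moreover" part, P is also assumed to have non-empty interior (a planar regular octagon in R^3 is otherwise a counterexample), and "linear image of the cube" is taken up to translation (e.g. [1,2] in R). *)

theory Defs
  imports "HOL-Analysis.Analysis" "HOL-Library.Set_Algebras"
begin

text \<open>Sums of sets are the Minkowski sums of \<^theory>\<open>HOL-Library.Set_Algebras\<close>.\<close>

definition vertices :: "'a::real_vector set \<Rightarrow> 'a set" where
  "vertices P = {v. v extreme_point_of P}"

text \<open>The supremum is taken in \<^typ>\<open>ereal\<close> because every real number belongs to the set
  when \<open>P\<close> is empty or a single point. For all other polytopes the set lies in \<open>[0, 1]\<close> and
  contains 0, so the supremum is the usual one in the reals.\<close>

definition vg_lambda :: "'a::real_vector set \<Rightarrow> ereal" where
  "vg_lambda P =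
     Sup (ereal ` {l. P = (*\<^sub>R) (1 - l) ` P + (*\<^sub>R) l ` vertices P})"

definition VG :: "real \<Rightarrow> (real ^ 'n) set set" where
  "VG l = {P. polytope P \<and> vg_lambda P \<ge> ereal l}"

end

theory Submission imports Defs begin

text \<open>
  If \<open>P\<close> is \<open>l\<close>-vertex generated, it is covered by the tiles \<open>(1 - l) P + l v\<close>, one for each vertex
  \<open>v\<close>, and comparing volumes bounds the number of vertices.

  For \<open>l = 1/2\<close> and \<open>2^n\<close> vertices the volumes add up exactly, so the tiles \<open>(P + v) / 2\<close> have
  disjoint interiors. Separating two of them shows that any two vertices lie on parallel
  supporting hyperplanes \<open>a = a v\<close> and \<open>a = a w\<close> of \<open>P\<close>. If \<open>[v, w]\<close> is an edge, only the tiles of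
  \<open>v\<close> and \<open>w\<close> come near its midpoint, and \<open>a\<close> separates them. Hence the tangent cone of \<open>P\<close> at \<open>v\<close>
  is the half \<open>a \<ge> 0\<close> of the tangent cone at the midpoint, which contains the line through \<open>v\<close>
  and \<open>w\<close>; so the cone at \<open>v\<close> is closed under projection along \<open>w - v\<close> onto \<open>a = 0\<close>.
  Consequently the functionals \<open>a\<close> belonging to the edges at \<open>v\<close> are a dual basis of the edge
  vectors, and \<open>P\<close> lies in the parallelepiped spanned by these. Walking along its edges from \<open>v\<close>,
  the same argument shows that every corner of the parallelepiped belongs to \<open>P\<close>.
\<close>

section \<open>Vertices and the covering by tiles\<close>

lemma vertices_subset: "vertices P \<subseteq> P"
  by (auto simp: vertices_def extreme_point_of_def)

lemma finite_vertices:
  fixes P :: "'a::euclidean_space set"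
  assumes "polytope P"
  shows "finite (vertices P)"
  unfolding vertices_def
  using assms finite_polyhedron_extreme_points polytope_imp_polyhedron by blast

text \<open>Take a point \<open>z\<close> minimising and a vertex \<open>v\<close> maximising a
  functional that is not constant on \<open>P\<close>. For \<open>l > 1\<close> the point
  \<open>(1 - l) z + l v\<close> would lie beyond the supporting hyperplane at
  \<open>v\<close>.\<close>

lemma generation_parameter_le_one:
  fixes P :: "'a::euclidean_space set"
  assumes "compact P" "convex P" and int: "interior P \<noteq> {}"
    and eq: "P = (*\<^sub>R) (1 - l) ` P + (*\<^sub>R) l ` vertices P"
  shows "l \<le> 1"
proof -
  obtain a :: 'a where "a \<noteq> 0"
    by (metis nonempty_Basis nonzero_Basis ex_in_conv)
  have "P \<noteq> {}" using int by auto
  have cont: "continuous_on P ((\<bullet>) a)" by (intro continuous_intros)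
  obtain x where x: "x \<in> P" "\<And>y. y \<in> P \<Longrightarrow> a \<bullet> y \<le> a \<bullet> x"
    using continuous_attains_sup[OF \<open>compact P\<close> \<open>P \<noteq> {}\<close> cont] by auto
  obtain z where z: "z \<in> P" "\<And>y. y \<in> P \<Longrightarrow> a \<bullet> z \<le> a \<bullet> y"
    using continuous_attains_inf[OF \<open>compact P\<close> \<open>P \<noteq> {}\<close> cont] by auto
  have less: "a \<bullet> z < a \<bullet> x"
  proof (rule ccontr)
    assume "\<not> a \<bullet> z < a \<bullet> x"
    then have "P \<subseteq> {y. a \<bullet> y = a \<bullet> x}"
      using x(2) z(2) by force
    then have "interior P \<subseteq> {}"
      using interior_mono interior_hyperplane[OF \<open>a \<noteq> 0\<close>] by metis
    then show False using int by simp
  qed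
  \<comment> \<open>Any extreme point of the face where \<open>a\<close> is maximal is a vertex of
    \<open>P\<close>.\<close>
  define F where "F = P \<inter> {y. a \<bullet> y = a \<bullet> x}"
  have F: "F face_of P"
    unfolding F_def by (rule face_of_Int_supporting_hyperplane_le) (use x \<open>convex P\<close> in auto)
  have "compact F" "convex F" "F \<noteq> {}"
    using F face_of_imp_compact face_of_imp_convex assms x(1) unfolding F_def by blast+
  then obtain v where "v extreme_point_of F"
    using extreme_point_exists_convex by blast
  then have v: "v \<in> vertices P" "a \<bullet> v = a \<bullet> x"
    using extreme_point_of_face[OF F] by (auto simp: vertices_def F_def)
  have "(1 - l) *\<^sub>R z + l *\<^sub>R v \<in> P"
    using z(1) v(1) by (subst eq) (auto intro: set_plus_intro)
  from x(2)[OF this] have "(1 - l) * (a \<bullet> z) + l * (a \<bullet> x) \<le> a \<bullet> x"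
    by (simp add: inner_add_right v(2))
  then have "(l - 1) * (a \<bullet> x - a \<bullet> z) \<le> 0" by (simp add: algebra_simps)
  then show ?thesis using less by (simp add: mult_le_0_iff)
qed

text \<open>The supremum defining \<^const>\<open>vg_lambda\<close> is attained: the cover exists for all smaller
  parameters, there are finitely many vertices, and \<open>P\<close> is closed.\<close>

lemma VG_cover:
  fixes P :: "(real ^ 'n) set"
  assumes P: "P \<in> VG l" and "l < 1" and int: "interior P \<noteq> {}"
  shows "P \<subseteq> (\<Union>v\<in>vertices P. (\<lambda>p. (1 - l) *\<^sub>R p + l *\<^sub>R v) ` P)"
proof
  fix x assume "x \<in> P"
  have poly: "polytope P" and sup: "ereal l \<le> vg_lambda P"
    using P by (auto simp: VG_def)
  have "compact P" "convex P" "closed P"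
    using poly polytope_imp_compact polytope_imp_convex polytope_imp_closed by auto
  \<comment> \<open>Some \<open>k > m\<close> generates \<open>P\<close> exactly, and the tile of
    \<open>v\<close> for \<open>k\<close> lies in its tile for \<open>m\<close>:
    \<open>(1 - k) p + k v = (1 - m) p' + m v\<close> with \<open>p'\<close> a convex combination of
    \<open>p\<close> and \<open>v\<close>.\<close>
  have below: "\<exists>v\<in>vertices P. (1 / (1 - m)) *\<^sub>R (x - m *\<^sub>R v) \<in> P" if "m < l" for m
  proof -
    have "ereal m < vg_lambda P"
      using that sup by (metis ereal_less(2) less_ereal.simps(1) order_less_le_trans)
    then obtain k where k: "m < k" and eq: "P = (*\<^sub>R) (1 - k) ` P + (*\<^sub>R) k ` vertices P"
      unfolding vg_lambda_def less_Sup_iff by auto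
    have "k \<le> 1"
      by (rule generation_parameter_le_one[OF \<open>compact P\<close> \<open>convex P\<close> int eq])
    have "x \<in> (*\<^sub>R) (1 - k) ` P + (*\<^sub>R) k ` vertices P"
      using \<open>x \<in> P\<close> eq by simp
    then obtain p v where pv: "p \<in> P" "v \<in> vertices P" "x = (1 - k) *\<^sub>R p + k *\<^sub>R v"
      by (auto simp: set_plus_def)
    have "((1 - k) / (1 - m)) *\<^sub>R p + ((k - m) / (1 - m)) *\<^sub>R v \<in> P"
      using pv(1,2) vertices_subset \<open>m < k\<close> \<open>k \<le> 1\<close>
      by (intro convexD[OF \<open>convex P\<close>]) (auto simp: add_divide_distrib[symmetric])
    also have "((1 - k) / (1 - m)) *\<^sub>R p + ((k - m) / (1 - m)) *\<^sub>R v
        = (1 / (1 - m)) *\<^sub>R (x - m *\<^sub>R v)"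
      by (simp add: pv(3) algebra_simps divide_inverse flip: scaleR_add_left)
    finally show ?thesis using pv(2) by blast
  qed
  have "\<exists>v\<in>vertices P. (1 / (1 - l)) *\<^sub>R (x - l *\<^sub>R v) \<in> P"
  proof (rule ccontr)
    assume contra: "\<not> ?thesis"
    have "\<forall>\<^sub>F m in at_left l. \<forall>v\<in>vertices P. (1 / (1 - m)) *\<^sub>R (x - m *\<^sub>R v) \<notin> P"
    proof (intro eventually_ball_finite finite_vertices[OF poly] ballI)
      fix v assume "v \<in> vertices P"
      then have "(1 / (1 - l)) *\<^sub>R (x - l *\<^sub>R v) \<in> - P" using contra by auto
      moreover have "((\<lambda>m. (1 / (1 - m)) *\<^sub>R (x - m *\<^sub>R v)) \<longlongrightarrow> (1 / (1 - l)) *\<^sub>R (x - l *\<^sub>R v)) (at_left l)"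
        using \<open>l < 1\<close> by (intro tendsto_intros) auto
      ultimately have "\<forall>\<^sub>F m in at_left l. (1 / (1 - m)) *\<^sub>R (x - m *\<^sub>R v) \<in> - P"
        using \<open>closed P\<close> topological_tendstoD open_Compl by blast
      then show "\<forall>\<^sub>F m in at_left l. (1 / (1 - m)) *\<^sub>R (x - m *\<^sub>R v) \<notin> P" by simp
    qed
    moreover have "\<forall>\<^sub>F m in at_left l. m < l"
      by (simp add: eventually_at_left_field) (meson lt_ex)
    ultimately have "\<forall>\<^sub>F m in at_left l. False"
      by eventually_elim (use below in blast)
    then show False by simp
  qed
  then obtain v where v: "v \<in> vertices P" "(1 / (1 - l)) *\<^sub>R (x - l *\<^sub>R v) \<in> P" by blast
  have "x = (1 - l) *\<^sub>R ((1 / (1 - l)) *\<^sub>R (x - l *\<^sub>R v)) + l *\<^sub>R v"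
    using \<open>l < 1\<close> by simp
  with v show "x \<in> (\<Union>v\<in>vertices P. (\<lambda>p. (1 - l) *\<^sub>R p + l *\<^sub>R v) ` P)" by blast
qed

section \<open>Volume comparison\<close>

lemma measure_pos_of_interior:
  fixes S :: "'a::euclidean_space set"
  assumes "S \<in> lmeasurable" "interior S \<noteq> {}"
  shows "0 < measure lebesgue S"
proof -
  have "\<not> negligible S"
    using assms open_not_negligible[of "interior S"] negligible_subset[OF _ interior_subset] by blast
  then have "measure lebesgue S \<noteq> 0"
    using assms(1) negligible_iff_measure by blast
  then show ?thesis by (simp add: zero_less_measure_iff)
qed

lemma lmeasurable_affine_image:
  fixes S :: "'a::euclidean_space set"
  assumes "compact S"
  shows "(\<lambda>x. c *\<^sub>R x + d) ` S \<in> lmeasurable"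
  by (intro lmeasurable_compact compact_continuous_image continuous_intros assms)

lemma card_cover_ge:
  fixes P :: "'a::euclidean_space set"
  assumes "compact P" "interior P \<noteq> {}" "finite V" "l < 1"
    and cover: "P \<subseteq> (\<Union>v\<in>V. (\<lambda>p. (1 - l) *\<^sub>R p + l *\<^sub>R v) ` P)"
  shows "1 / (1 - l) ^ DIM('a) \<le> real (card V)"
proof -
  have P: "P \<in> lmeasurable" using \<open>compact P\<close> by (rule lmeasurable_compact)
  have pos: "0 < measure lebesgue P"
    using measure_pos_of_interior P assms(2) by blast
  have meas: "(\<lambda>p. (1 - l) *\<^sub>R p + l *\<^sub>R v) ` P \<in> lmeasurable" for v
    by (rule lmeasurable_affine_image[OF \<open>compact P\<close>])
  have "measure lebesgue P \<le> measure lebesgue (\<Union>v\<in>V. (\<lambda>p. (1 - l) *\<^sub>R p + l *\<^sub>R v) ` P)"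
    by (intro measure_mono_fmeasurable cover fmeasurableD P fmeasurable.finite_UN meas \<open>finite V\<close>)
  also have "\<dots> \<le> (\<Sum>v\<in>V. measure lebesgue ((\<lambda>p. (1 - l) *\<^sub>R p + l *\<^sub>R v) ` P))"
    using meas by (intro measure_UNION_le \<open>finite V\<close> fmeasurableD) auto
  also have "\<dots> = real (card V) * (1 - l) ^ DIM('a) * measure lebesgue P"
    using \<open>l < 1\<close> by (simp add: measure_lebesgue_affine)
  finally have "1 \<le> real (card V) * (1 - l) ^ DIM('a)"
    using pos by simp
  then show ?thesis using \<open>l < 1\<close> by (simp add: divide_le_eq)
qed

text \<open>Removing \<open>A i\<close> from \<open>A j\<close> keeps the cover but lowers the sum
  of the measures by that of the overlap. A tight sum leaves no room for this unless the overlap is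
  null.\<close>

lemma negligible_Int_if_tight_cover:
  assumes "finite I" and A: "\<And>k. k \<in> I \<Longrightarrow> A k \<in> lmeasurable"
    and cover: "P \<subseteq> (\<Union>k\<in>I. A k)" and "P \<in> sets lebesgue"
    and tight: "(\<Sum>k\<in>I. measure lebesgue (A k)) \<le> measure lebesgue P"
    and ij: "i \<in> I" "j \<in> I" "i \<noteq> j"
  shows "negligible (A i \<inter> A j)"
proof -
  define B where "B = A(j := A j - A i)"
  have B: "B k \<in> lmeasurable" if "k \<in> I" for k
    using A[OF that] A ij by (simp add: B_def fmeasurable.Diff)
  have Aij: "A i \<inter> A j \<in> lmeasurable" using A ij by blast
  have "P \<subseteq> (\<Union>k\<in>I. B k)"
    using cover ij by (fastforce simp: B_def)
  then have "measure lebesgue P \<le> measure lebesgue (\<Union>k\<in>I. B k)"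
    by (intro measure_mono_fmeasurable \<open>P \<in> sets lebesgue\<close> fmeasurable.finite_UN B \<open>finite I\<close>)
  also have "\<dots> \<le> (\<Sum>k\<in>I. measure lebesgue (B k))"
    by (intro measure_UNION_le \<open>finite I\<close> fmeasurableD B)
  also have "\<dots> = measure lebesgue (A j - A i) + (\<Sum>k\<in>I-{j}. measure lebesgue (A k))"
    using \<open>finite I\<close> ij by (simp add: sum.remove[of I j] B_def)
  also have "A j - A i = A j - A i \<inter> A j" by blast
  also have "measure lebesgue \<dots> = measure lebesgue (A j) - measure lebesgue (A i \<inter> A j)"
    using A ij Aij by (intro measurable_measure_Diff) auto
  also have "measure lebesgue (A j) - measure lebesgue (A i \<inter> A j)
        + (\<Sum>k\<in>I-{j}. measure lebesgue (A k))
      = (\<Sum>k\<in>I. measure lebesgue (A k)) - measure lebesgue (A i \<inter> A j)"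
    using \<open>finite I\<close> ij by (simp add: sum.remove[of I j])
  finally have "measure lebesgue (A i \<inter> A j) \<le> 0" using tight by linarith
  then show ?thesis
    using Aij by (simp add: negligible_iff_measure measure_le_0_iff)
qed

section \<open>Separation of tiles\<close>

text \<open>The interiors can be separated, and the weak inequalities pass to their closures, which
  contain \<open>S\<close> and \<open>T\<close>.\<close>

lemma separating_hyperplane_interior_disjoint:
  fixes S T :: "'a::euclidean_space set"
  assumes "convex S" "convex T" "interior S \<noteq> {}" "interior T \<noteq> {}"
    and "interior (S \<inter> T) = {}"
  obtains a b where "a \<noteq> 0" "\<And>x. x \<in> S \<Longrightarrow> a \<bullet> x \<le> b" "\<And>x. x \<in> T \<Longrightarrow> b \<le> a \<bullet> x"
proof -
  have "interior S \<inter> interior T = {}" using assms(5) by simp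
  then obtain a b where a: "a \<noteq> 0" "\<forall>x\<in>interior S. a \<bullet> x \<le> b" "\<forall>x\<in>interior T. b \<le> a \<bullet> x"
    using separating_hyperplane_sets[of "interior S" "interior T"] assms
    by (auto simp: convex_interior)
  have "closure (interior S) \<subseteq> {x. a \<bullet> x \<le> b}"
    using a(2) by (intro closure_minimal closed_halfspace_le) auto
  moreover have "closure (interior T) \<subseteq> {x. a \<bullet> x \<ge> b}"
    using a(3) by (intro closure_minimal closed_halfspace_ge) auto
  moreover have "S \<subseteq> closure (interior S)" "T \<subseteq> closure (interior T)"
    using assms closure_subset by (simp_all add: convex_closure_interior)
  ultimately show ?thesis using a(1) that by blast
qed

lemma interior_half_tile:
  fixes P :: "'a::euclidean_space set"
  assumes "interior P \<noteq> {}"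
  shows "interior ((\<lambda>p. (1/2) *\<^sub>R p + c) ` P) \<noteq> {}"
proof -
  have "(\<lambda>p. (1/2) *\<^sub>R p + c) ` interior P \<subseteq> interior ((\<lambda>p. (1/2) *\<^sub>R p + c) ` P)"
  proof (rule interior_maximal)
    have "(\<lambda>p. (1/2) *\<^sub>R p + c) ` interior P = (+) c ` ((*\<^sub>R) (1/2) ` interior P)"
      by (auto simp: image_image add.commute)
    then show "open ((\<lambda>p. (1/2) *\<^sub>R p + c) ` interior P)"
      by (simp add: open_scaling open_translation)
  qed (use interior_subset in blast)
  then show ?thesis using assms by blast
qed

lemma antipodal_if_tight_half_cover:
  fixes P :: "'a::euclidean_space set"
  assumes "compact P" "convex P" "interior P \<noteq> {}" "V \<subseteq> P" "card V = 2 ^ DIM('a)"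
    and cover: "P \<subseteq> (\<Union>v\<in>V. (\<lambda>p. (1/2) *\<^sub>R p + (1/2) *\<^sub>R v) ` P)"
    and vw: "v \<in> V" "w \<in> V" "v \<noteq> w"
  obtains a where "a \<noteq> 0" "\<And>p. p \<in> P \<Longrightarrow> a \<bullet> v \<le> a \<bullet> p" "\<And>p. p \<in> P \<Longrightarrow> a \<bullet> p \<le> a \<bullet> w"
proof -
  let ?T = "\<lambda>v. (\<lambda>p. (1/2) *\<^sub>R p + (1/2) *\<^sub>R v) ` P"
  have "finite V" using assms(5) card.infinite by fastforce
  have "negligible (?T v \<inter> ?T w)"
  proof (rule negligible_Int_if_tight_cover[OF \<open>finite V\<close> _ cover _ _ vw])
    show "?T k \<in> lmeasurable" for k
      by (rule lmeasurable_affine_image[OF \<open>compact P\<close>])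
    show "P \<in> sets lebesgue"
      using \<open>compact P\<close> lmeasurable_compact by blast
    show "(\<Sum>k\<in>V. measure lebesgue (?T k)) \<le> measure lebesgue P"
      using assms(5) by (simp add: measure_lebesgue_affine power_one_over)
  qed
  then have "interior (?T v \<inter> ?T w) = {}"
    by (metis interior_subset negligible_subset open_interior open_not_negligible)
  moreover have "convex (?T k)" for k
    using convex_affinity[OF \<open>convex P\<close>, of "(1/2) *\<^sub>R k" "1/2"] by (simp add: add.commute)
  ultimately obtain a b where a: "a \<noteq> 0" "\<And>x. x \<in> ?T v \<Longrightarrow> a \<bullet> x \<le> b"
      "\<And>x. x \<in> ?T w \<Longrightarrow> b \<le> a \<bullet> x"
    using separating_hyperplane_interior_disjoint[of "?T v" "?T w"]
      interior_half_tile[OF \<open>interior P \<noteq> {}\<close>] by metis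
  \<comment> \<open>Both sides are compared with \<open>2 b\<close>. Then \<open>p = w\<close> shows
    that \<open>a\<close> is minimal at \<open>v\<close>, and \<open>q = v\<close> that it is
    maximal at \<open>w\<close>.\<close>
  have key: "a \<bullet> p + a \<bullet> v \<le> a \<bullet> q + a \<bullet> w" if "p \<in> P" "q \<in> P" for p q
    using a(2)[of "(1/2) *\<^sub>R p + (1/2) *\<^sub>R v"] a(3)[of "(1/2) *\<^sub>R q + (1/2) *\<^sub>R w"] that
    by (auto simp: inner_add_right)
  show ?thesis
    using that[OF a(1)] key[of w] key[of _ v] vw \<open>V \<subseteq> P\<close> by force
qed

section \<open>Edges of a polytope\<close>

text \<open>Induction on the dimension. In dimension 1 the polytope is a segment; above that,
  \<open>v\<close> lies on the relative frontier, hence in a facet, and faces of the facet are faces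
  of \<open>F\<close>.\<close>

lemma edge_at_extreme_point:
  fixes F :: "'a::euclidean_space set"
  assumes "polytope F" "v extreme_point_of F" "F \<noteq> {v}"
  shows "\<exists>u. u \<noteq> v \<and> u extreme_point_of F \<and> closed_segment v u face_of F"
  using assms
proof (induction "nat (aff_dim F)" arbitrary: F rule: less_induct)
  case less
  have v: "v \<in> F" using less.prems(2) by (simp add: extreme_point_of_def)
  have cc: "compact F" "convex F"
    using less.prems(1) polytope_imp_compact polytope_imp_convex by auto
  obtain y where "y \<in> F" "y \<noteq> v" using less.prems(3) v by blast
  have "aff_dim {v, y} \<le> aff_dim F"
    using v \<open>y \<in> F\<close> by (intro aff_dim_subset) auto
  then have dim: "1 \<le> aff_dim F" using \<open>y \<noteq> v\<close> by (simp add: aff_dim_2)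
  show ?case
  proof (cases "aff_dim F \<le> 1")
    case True
    then have "collinear F" by (simp add: collinear_aff_dim)
    then obtain b c where F: "F = closed_segment b c"
      using compact_convex_collinear_segment[of F] cc v by blast
    have "F face_of F" using cc by (simp add: face_of_refl)
    moreover have "b \<noteq> c" using F less.prems(3) v by auto
    moreover have "v = b \<or> v = c"
      using less.prems(2) by (simp add: F extreme_point_of_segment)
    ultimately show ?thesis
      by (metis F closed_segment_commute extreme_point_of_segment)
  next
    case False
    have "v \<in> rel_frontier F"
      using extreme_point_not_in_REL_INTERIOR less.prems(2,3) v closure_subset
      by (fastforce simp: rel_frontier_def)
    then obtain C where C: "C facet_of F" "v \<in> C"
      using rel_frontier_of_polyhedron polytope_imp_polyhedron less.prems(1) by blast
    then have face: "C face_of F" and dimC: "aff_dim C = aff_dim F - 1"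
      by (auto simp: facet_of_def)
    have ext: "x extreme_point_of C \<longleftrightarrow> x extreme_point_of F \<and> x \<in> C" for x
      by (rule extreme_point_of_face[OF face])
    have "nat (aff_dim C) < nat (aff_dim F)" using dim dimC by simp
    moreover have "polytope C" using face less.prems(1) face_of_polytope_polytope by blast
    moreover have "v extreme_point_of C" using ext less.prems(2) C by simp
    moreover have "C \<noteq> {v}" using dimC False by auto
    ultimately obtain u where "u \<noteq> v" "u extreme_point_of C" "closed_segment v u face_of C"
      using less.hyps by blast
    then show ?thesis using face face_of_trans ext by blast
  qed
qed

section \<open>Tangent cones along an edge\<close>

text \<open>The condition \<open>2 *\<^sub>R x - v \<in> P\<close> says that \<open>x\<close> lies
  in the tile \<open>(P + v) / 2\<close>. Volumes enter from here on only through
  antipodality.\<close>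

locale antipodal_half_cover =
  fixes P :: "'a::euclidean_space set"
  assumes polytope: "polytope P"
    and interior: "interior P \<noteq> {}"
    and cover: "x \<in> P \<Longrightarrow> \<exists>v\<in>vertices P. 2 *\<^sub>R x - v \<in> P"
    and antipodal: "\<lbrakk>v \<in> vertices P; w \<in> vertices P; v \<noteq> w\<rbrakk>
      \<Longrightarrow> \<exists>a. a \<noteq> 0 \<and> (\<forall>p\<in>P. a \<bullet> v \<le> a \<bullet> p \<and> a \<bullet> p \<le> a \<bullet> w)"
begin

lemma convex: "convex P" and closed: "closed P"
  using polytope polytope_imp_convex polytope_imp_closed by auto

text \<open>\<open>feasible x\<close> is the tangent cone of \<open>P\<close> at \<open>x\<close>.\<close>

definition feasible :: "'a \<Rightarrow> 'a \<Rightarrow> bool" where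
  "feasible x d \<longleftrightarrow> (\<exists>t>0. x + t *\<^sub>R d \<in> P)"

lemma add_scaleR_mem:
  assumes "x \<in> P" "x + t *\<^sub>R d \<in> P" "0 \<le> s" "s \<le> t"
  shows "x + s *\<^sub>R d \<in> P"
proof (cases "t = 0")
  case True then show ?thesis using assms by simp
next
  case False
  then have "t > 0" using assms by simp
  then have "(1 - s / t) *\<^sub>R x + (s / t) *\<^sub>R (x + t *\<^sub>R d) \<in> P"
    using assms by (intro convexD_alt[OF convex]) auto
  also have "(1 - s / t) *\<^sub>R x + (s / t) *\<^sub>R (x + t *\<^sub>R d) = x + s *\<^sub>R d"
    using False by (simp add: algebra_simps)
  finally show ?thesis .
qed

text \<open>The antipodal functional is scaled to rise by 1 from \<open>v\<close> to
  \<open>w\<close>. Its rise is positive, since otherwise \<open>P\<close> would lie in a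
  hyperplane.\<close>

lemma separating_functional:
  assumes v: "v \<in> vertices P" and w: "w \<in> vertices P" and "v \<noteq> w"
  obtains a where "\<And>p. p \<in> P \<Longrightarrow> 0 \<le> a \<bullet> (p - v)" "\<And>p. p \<in> P \<Longrightarrow> a \<bullet> (p - v) \<le> 1"
    "a \<bullet> (w - v) = 1"
proof -
  obtain a where "a \<noteq> 0" and a: "\<And>p. p \<in> P \<Longrightarrow> a \<bullet> v \<le> a \<bullet> p \<and> a \<bullet> p \<le> a \<bullet> w"
    using antipodal[OF assms] by blast
  define s where "s = a \<bullet> (w - v)"
  have "s > 0"
  proof (rule ccontr)
    assume "\<not> s > 0"
    then have "a \<bullet> w \<le> a \<bullet> v" by (simp add: s_def inner_diff_right)
    then have "P \<subseteq> {x. a \<bullet> x = a \<bullet> v}" using a by force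
    then have "interior P \<subseteq> {}"
      using interior_mono interior_hyperplane[OF \<open>a \<noteq> 0\<close>] by metis
    then show False using interior by simp
  qed
  show ?thesis
  proof (rule that[of "(1 / s) *\<^sub>R a"])
    show "0 \<le> ((1 / s) *\<^sub>R a) \<bullet> (p - v)" if "p \<in> P" for p
      using a[OF that] \<open>s > 0\<close> by (simp add: inner_diff_right divide_right_mono)
    show "((1 / s) *\<^sub>R a) \<bullet> (p - v) \<le> 1" if "p \<in> P" for p
      using a[OF that] \<open>s > 0\<close> by (simp add: inner_diff_right s_def divide_simps)
    show "((1 / s) *\<^sub>R a) \<bullet> (w - v) = 1" using \<open>s > 0\<close> by (simp flip: s_def)
  qed
qed

text \<open>If the tile of another vertex \<open>z\<close> contained the midpoint, the latter would
  lie halfway between \<open>z\<close> and a point of \<open>P\<close>. The edge is a face, so it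
  would contain \<open>z\<close>, but its only vertices are \<open>v\<close> and \<open>w\<close>.
  As the tiles are closed and finite in number, a whole neighbourhood avoids the others.\<close>

lemma near_edge_midpoint:
  assumes v: "v \<in> vertices P" and w: "w \<in> vertices P" and "v \<noteq> w"
    and edge: "closed_segment v w face_of P"
  shows "\<exists>\<delta>>0. \<forall>x\<in>P. dist x ((1/2) *\<^sub>R (v + w)) < \<delta> \<longrightarrow> 2 *\<^sub>R x - v \<in> P \<or> 2 *\<^sub>R x - w \<in> P"
proof -
  let ?m = "(1/2) *\<^sub>R (v + w)"
  have fin: "finite (vertices P)" by (rule finite_vertices[OF polytope])
  have far: "2 *\<^sub>R ?m - z \<notin> P" if z: "z \<in> vertices P - {v, w}" for z
  proof
    assume mem: "2 *\<^sub>R ?m - z \<in> P"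
    have ze: "z extreme_point_of P" "z \<in> P"
      using z vertices_subset by (auto simp: vertices_def)
    have z_seg: "z \<notin> closed_segment v w"
      using ze(1) z extreme_point_of_face[OF edge] extreme_point_of_segment by blast
    have m_seg: "?m \<in> closed_segment v w"
      unfolding in_segment by (intro exI[of _ "1/2"]) (simp add: scaleR_add_right)
    have ne: "2 *\<^sub>R ?m - z \<noteq> z"
    proof
      assume "2 *\<^sub>R ?m - z = z"
      then have "2 *\<^sub>R ?m = 2 *\<^sub>R z" by (simp add: scaleR_2 algebra_simps)
      then have "?m = z" by (metis scaleR_cancel_left zero_neq_numeral)
      then show False using m_seg z_seg by simp
    qed
    have "?m \<in> open_segment z (2 *\<^sub>R ?m - z)"
      using ne unfolding in_segment
      by (intro conjI exI[of _ "1/2"]) (simp_all add: scaleR_add_right scaleR_diff_right)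
    then have "z \<in> closed_segment v w"
      using edge m_seg mem ze(2) unfolding face_of_def by blast
    then show False using z_seg by contradiction
  qed
  have "\<forall>\<^sub>F x in nhds ?m. \<forall>z\<in>vertices P - {v, w}. 2 *\<^sub>R x - z \<notin> P"
  proof (intro eventually_ball_finite ballI)
    show "finite (vertices P - {v, w})" using fin by simp
    fix z assume "z \<in> vertices P - {v, w}"
    then have "2 *\<^sub>R ?m - z \<in> - P" using far by simp
    moreover have "((\<lambda>x. 2 *\<^sub>R x - z) \<longlongrightarrow> 2 *\<^sub>R ?m - z) (nhds ?m)"
      by (intro tendsto_intros filterlim_ident)
    ultimately have "\<forall>\<^sub>F x in nhds ?m. 2 *\<^sub>R x - z \<in> - P"
      using closed topological_tendstoD open_Compl by blast
    then show "\<forall>\<^sub>F x in nhds ?m. 2 *\<^sub>R x - z \<notin> P" by simp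
  qed
  then obtain \<delta> where "\<delta> > 0" and
    \<delta>: "\<And>x. dist x ?m < \<delta> \<Longrightarrow> \<forall>z\<in>vertices P - {v, w}. 2 *\<^sub>R x - z \<notin> P"
    unfolding eventually_nhds_metric by blast
  show ?thesis
  proof (intro exI[of _ \<delta>] conjI ballI impI \<open>\<delta> > 0\<close>)
    fix x assume x: "x \<in> P" "dist x ?m < \<delta>"
    obtain z where "z \<in> vertices P" "2 *\<^sub>R x - z \<in> P" using cover[OF x(1)] by blast
    then show "2 *\<^sub>R x - v \<in> P \<or> 2 *\<^sub>R x - w \<in> P" using \<delta>[OF x(2)] by blast
  qed
qed

text \<open>Since \<open>a\<close> is at most \<open>a \<bullet> w\<close> on \<open>P\<close>, the
  tile of \<open>v\<close> stays at or below the level of the midpoint. Strictly above that level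
  only the tile of \<open>w\<close> remains; the level itself follows by a limit.\<close>

lemma edge_midpoint_halfspace:
  assumes v: "v \<in> vertices P" and w: "w \<in> vertices P" and "v \<noteq> w"
    and edge: "closed_segment v w face_of P"
    and a: "\<And>p. p \<in> P \<Longrightarrow> a \<bullet> p \<le> a \<bullet> w" and vw: "a \<bullet> v < a \<bullet> w"
  shows "\<exists>\<delta>>0. \<forall>x\<in>P. dist x ((1/2) *\<^sub>R (v + w)) < \<delta> \<longrightarrow> a \<bullet> (v + w) \<le> 2 * (a \<bullet> x)
    \<longrightarrow> 2 *\<^sub>R x - w \<in> P"
proof -
  let ?m = "(1/2) *\<^sub>R (v + w)"
  obtain \<delta> where "\<delta> > 0" and
    \<delta>: "\<And>x. x \<in> P \<Longrightarrow> dist x ?m < \<delta> \<Longrightarrow> 2 *\<^sub>R x - v \<in> P \<or> 2 *\<^sub>R x - w \<in> P"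
    using near_edge_midpoint[OF v w \<open>v \<noteq> w\<close> edge] by blast
  have strict: "2 *\<^sub>R x - w \<in> P"
    if "x \<in> P" "dist x ?m < \<delta>" "a \<bullet> (v + w) < 2 * (a \<bullet> x)" for x
    using \<delta>[OF that(1,2)] a[of "2 *\<^sub>R x - v"] that(3)
    by (auto simp: inner_diff_right inner_add_right)
  show ?thesis
  proof (intro exI[of _ \<delta>] conjI ballI impI \<open>\<delta> > 0\<close>)
    fix x assume x: "x \<in> P" "dist x ?m < \<delta>" "a \<bullet> (v + w) \<le> 2 * (a \<bullet> x)"
    show "2 *\<^sub>R x - w \<in> P"
    proof (cases "a \<bullet> (v + w) < 2 * (a \<bullet> x)")
      case True then show ?thesis using strict x by blast
    next
      case False
      then have ax: "2 * (a \<bullet> x) = a \<bullet> v + a \<bullet> w" using x(3) by (simp add: inner_add_right)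
      \<comment> \<open>A point on the level of the midpoint is pushed slightly towards
        \<open>w\<close>, which strictly raises \<open>a\<close>; closedness of \<open>P\<close>
        brings the result back to \<open>x\<close>.\<close>
      have lim: "((\<lambda>s. x + s *\<^sub>R (w - x)) \<longlongrightarrow> x + 0 *\<^sub>R (w - x)) (at_right 0)"
        by (intro tendsto_intros)
      have ev_dist: "\<forall>\<^sub>F s in at_right 0. dist (x + s *\<^sub>R (w - x)) ?m < \<delta>"
        using tendsto_dist[OF lim tendsto_const[of ?m]] x(2) by (auto dest: order_tendstoD(2))
      have ev1: "\<forall>\<^sub>F s in at_right 0. (s::real) < 1" and ev0: "\<forall>\<^sub>F s in at_right 0. (s::real) > 0"
        by (auto simp: eventually_at_right_less intro: eventually_at_right_real
            eventually_at_rightI[of 0 1])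
      have "\<forall>\<^sub>F s in at_right 0. 2 *\<^sub>R (x + s *\<^sub>R (w - x)) - w \<in> P"
        using ev_dist ev0 ev1
      proof eventually_elim
        case (elim s)
        have "w \<in> P" using w vertices_subset by blast
        then have "x + s *\<^sub>R (w - x) \<in> P"
          using elim(2,3) x(1) add_scaleR_mem[of x 1 "w - x" s] by simp
        moreover have "0 < s * (a \<bullet> w - a \<bullet> x)"
          using elim vw ax by (intro mult_pos_pos) auto
        then have "a \<bullet> (v + w) < 2 * (a \<bullet> (x + s *\<^sub>R (w - x)))"
          using ax by (simp add: inner_add_right inner_diff_right)
        ultimately show ?case using strict elim(1) by blast
      qed
      moreover have "((\<lambda>s. 2 *\<^sub>R (x + s *\<^sub>R (w - x)) - w) \<longlongrightarrow> 2 *\<^sub>R (x + 0 *\<^sub>R (w - x)) - w) (at_right 0)"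
        by (intro tendsto_intros)
      ultimately have "2 *\<^sub>R (x + 0 *\<^sub>R (w - x)) - w \<in> P"
        using Lim_in_closed_set[OF closed] by (metis trivial_limit_at_right_real)
      then show ?thesis by simp
    qed
  qed
qed

text \<open>The map \<open>x \<mapsto> 2 x - w\<close> sends the midpoint to \<open>v\<close> and
  doubles directions, and near the midpoint it takes the upper half of \<open>P\<close> into
  \<open>P\<close>.\<close>

lemma feasible_from_midpoint:
  assumes v: "v \<in> vertices P" and w: "w \<in> vertices P" and "v \<noteq> w"
    and edge: "closed_segment v w face_of P"
    and a: "\<And>p. p \<in> P \<Longrightarrow> a \<bullet> p \<le> a \<bullet> w" "a \<bullet> v < a \<bullet> w"
    and d: "feasible ((1/2) *\<^sub>R (v + w)) d" "0 \<le> a \<bullet> d"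
  shows "feasible v d"
proof -
  let ?m = "(1/2) *\<^sub>R (v + w)"
  obtain \<delta> where "\<delta> > 0" and \<delta>: "\<And>x. x \<in> P \<Longrightarrow> dist x ?m < \<delta>
      \<Longrightarrow> a \<bullet> (v + w) \<le> 2 * (a \<bullet> x) \<Longrightarrow> 2 *\<^sub>R x - w \<in> P"
    using edge_midpoint_halfspace[OF v w \<open>v \<noteq> w\<close> edge a] by blast
  obtain t where t: "t > 0" "?m + t *\<^sub>R d \<in> P" using d(1) by (auto simp: feasible_def)
  \<comment> \<open>Short enough to stay within \<open>\<delta>\<close> of the midpoint; the summand
    1 covers \<open>d = 0\<close>.\<close>
  define s where "s = min t (\<delta> / (norm d + 1))"
  have nd: "norm d + 1 > 0" using norm_ge_zero[of d] by linarith
  have "s > 0" using t(1) \<open>\<delta> > 0\<close> nd by (simp add: s_def)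
  have "v \<in> P" "w \<in> P" using v w vertices_subset by auto
  then have "?m \<in> P"
    using convexD[OF convex, of v w "1/2" "1/2"] by (simp add: scaleR_add_right)
  then have x: "?m + s *\<^sub>R d \<in> P"
    using t \<open>s > 0\<close> add_scaleR_mem[of ?m t d s] by (simp add: s_def)
  have "s * norm d < s * (norm d + 1)" using \<open>s > 0\<close> by simp
  also have "\<dots> \<le> \<delta> / (norm d + 1) * (norm d + 1)"
    using nd by (intro mult_right_mono) (auto simp: s_def)
  also have "\<dots> = \<delta>" using nd by simp
  finally have "dist (?m + s *\<^sub>R d) ?m < \<delta>" using \<open>s > 0\<close> by (simp add: dist_norm)
  moreover have "a \<bullet> (v + w) \<le> 2 * (a \<bullet> (?m + s *\<^sub>R d))"
    using d(2) \<open>s > 0\<close> by (simp add: inner_add_right add_divide_distrib)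
  ultimately have "2 *\<^sub>R (?m + s *\<^sub>R d) - w \<in> P" using \<delta> x by blast
  also have "2 *\<^sub>R (?m + s *\<^sub>R d) - w = v + (2 * s) *\<^sub>R d"
    by (simp add: scaleR_add_right)
  finally show ?thesis using \<open>s > 0\<close> unfolding feasible_def by (intro exI[of _ "2 * s"]) simp
qed

text \<open>From the midpoint one can move both ways along the edge, so any multiple of
  \<open>w - v\<close> may be added to a direction feasible at \<open>v\<close>.\<close>

lemma feasible_midpoint:
  assumes "v \<in> P" "w \<in> P" "feasible v d"
  shows "feasible ((1/2) *\<^sub>R (v + w)) (d + s *\<^sub>R (w - v))"
proof -
  obtain t where t: "t > 0" "v + t *\<^sub>R d \<in> P" using assms(3) by (auto simp: feasible_def)
  \<comment> \<open>The target point has coefficients \<open>1/2 - r s - r/t\<close>,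
    \<open>1/2 + r s\<close> and \<open>r/t\<close> at \<open>v\<close>, \<open>w\<close> and
    \<open>v + t d\<close>. With \<open>\<bar>r s\<bar> + r/t = 1/2\<close> all are
    nonnegative.\<close>
  define r where "r = 1 / (2 * (\<bar>s\<bar> + 1 / t))"
  have pos: "\<bar>s\<bar> + 1 / t > 0" using t(1) by (simp add: add_nonneg_pos)
  then have "r > 0" by (simp add: r_def)
  have "r * (\<bar>s\<bar> + 1 / t) = 1 / 2" using pos by (simp add: r_def)
  then have half: "\<bar>r * s\<bar> + r / t = 1 / 2" using \<open>r > 0\<close> by (simp add: algebra_simps abs_mult)
  have "r / t > 0" using t(1) \<open>r > 0\<close> by simp
  define y where "y = (1 / (1 - r / t)) *\<^sub>R ((1/2 - r * s - r / t) *\<^sub>R v + (1/2 + r * s) *\<^sub>R w)"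
  have rt: "r / t < 1" using half by linarith
  then have "1 - r / t \<noteq> 0" by linarith
  then have inv: "(1 - r / t) * (1 / (1 - r / t)) = 1"
    unfolding inverse_eq_divide[symmetric] by (rule right_inverse)
  have "((1/2 - r * s - r / t) / (1 - r / t)) *\<^sub>R v + ((1/2 + r * s) / (1 - r / t)) *\<^sub>R w \<in> P"
  proof (rule convexD[OF convex assms(1,2)])
    have "0 \<le> 1/2 - r * s - r / t" "0 \<le> 1/2 + r * s" using half \<open>r / t > 0\<close> by linarith+
    then show "0 \<le> (1/2 - r * s - r / t) / (1 - r / t)" "0 \<le> (1/2 + r * s) / (1 - r / t)"
      using rt by (simp_all add: divide_nonneg_pos)
    show "(1/2 - r * s - r / t) / (1 - r / t) + (1/2 + r * s) / (1 - r / t) = 1"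
      using rt by (subst add_divide_distrib[symmetric]) auto
  qed
  then have "y \<in> P" by (simp add: y_def scaleR_add_right)
  then have "(1 - r / t) *\<^sub>R y + (r / t) *\<^sub>R (v + t *\<^sub>R d) \<in> P"
    using t rt \<open>r / t > 0\<close> by (intro convexD_alt[OF convex]) auto
  also have "(1 - r / t) *\<^sub>R y = (1/2 - r * s - r / t) *\<^sub>R v + (1/2 + r * s) *\<^sub>R w"
    unfolding y_def by (simp only: scaleR_scaleR inv scaleR_one)
  also have "(1/2 - r * s - r / t) *\<^sub>R v + (1/2 + r * s) *\<^sub>R w + (r / t) *\<^sub>R (v + t *\<^sub>R d)
      = (1/2) *\<^sub>R (v + w) + r *\<^sub>R (d + s *\<^sub>R (w - v))"
    using t(1) by (simp add: algebra_simps)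
  finally show ?thesis using \<open>r > 0\<close> unfolding feasible_def by blast
qed

definition neighbours :: "'a \<Rightarrow> 'a set" where
  "neighbours v = {w \<in> vertices P. w \<noteq> v \<and> closed_segment v w face_of P}"

text \<open>The direction is carried to the midpoint, where a multiple of \<open>w - v\<close> may
  be subtracted. The result has \<open>a\<close>-value 0 and so is feasible at \<open>v\<close>
  again.\<close>

lemma feasible_project:
  assumes v: "v \<in> vertices P" and w: "w \<in> neighbours v"
    and a: "\<And>p. p \<in> P \<Longrightarrow> a \<bullet> (p - v) \<le> 1" "a \<bullet> (w - v) = 1"
    and d: "feasible v d"
  shows "feasible v (d - (a \<bullet> d) *\<^sub>R (w - v))"
proof (rule feasible_from_midpoint[OF v])
  show "w \<in> vertices P" "v \<noteq> w" "closed_segment v w face_of P"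
    using w by (auto simp: neighbours_def)
  show "a \<bullet> p \<le> a \<bullet> w" if "p \<in> P" for p
    using a(1)[OF that] a(2) by (simp add: inner_diff_right)
  show "a \<bullet> v < a \<bullet> w" using a(2) by (simp add: inner_diff_right)
  show "feasible ((1/2) *\<^sub>R (v + w)) (d - (a \<bullet> d) *\<^sub>R (w - v))"
    using feasible_midpoint[of v w d "- (a \<bullet> d)"] v \<open>w \<in> vertices P\<close> d vertices_subset by auto
  show "0 \<le> a \<bullet> (d - (a \<bullet> d) *\<^sub>R (w - v))"
    using a(2) by (simp add: inner_diff_right[of _ _ "_ *\<^sub>R _"])
qed

text \<open>A positive value \<open>s\<close> would make \<open>u - v - s (w - v)\<close> feasible
  at \<open>v\<close>. Joining a point \<open>q\<close> in that direction to \<open>w\<close> meets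
  the edge from \<open>v\<close> to \<open>u\<close>, which forces the vertex \<open>w\<close> onto
  this edge.\<close>

lemma inner_other_neighbour:
  assumes v: "v \<in> vertices P" and w: "w \<in> neighbours v" and u: "u \<in> neighbours v" "u \<noteq> w"
    and a: "\<And>p. p \<in> P \<Longrightarrow> 0 \<le> a \<bullet> (p - v)" "\<And>p. p \<in> P \<Longrightarrow> a \<bullet> (p - v) \<le> 1" "a \<bullet> (w - v) = 1"
  shows "a \<bullet> (u - v) = 0"
proof (rule ccontr)
  define s where "s = a \<bullet> (u - v)"
  have ver: "w \<in> vertices P" "u \<in> vertices P" "w \<noteq> v" and edge: "closed_segment v u face_of P"
    using w u by (auto simp: neighbours_def)
  then have mem: "v \<in> P" "w \<in> P" "u \<in> P" using v vertices_subset by auto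
  assume "a \<bullet> (u - v) \<noteq> 0"
  then have "s > 0" using a(1)[OF mem(3)] by (simp add: s_def)
  have "feasible v (u - v)"
    unfolding feasible_def using mem by (intro exI[of _ 1]) simp
  from feasible_project[OF v w a(2,3) this]
  obtain t where t: "t > 0" "v + t *\<^sub>R (u - v - s *\<^sub>R (w - v)) \<in> P"
    by (auto simp: feasible_def s_def)
  define r where "r = min t 1"
  have r: "0 < r" "r \<le> 1" "r \<le> t" using t by (auto simp: r_def)
  define q where "q = v + r *\<^sub>R (u - v - s *\<^sub>R (w - v))"
  have "q \<in> P" unfolding q_def using add_scaleR_mem[OF mem(1) t(2), of r] r by simp
  have rs: "r * s > 0" using r \<open>s > 0\<close> by simp
  \<comment> \<open>This weight cancels the \<open>w\<close>-component of \<open>q\<close>, leaving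
    a combination of \<open>v\<close> and \<open>u\<close>.\<close>
  define k where "k = r * s / (1 + r * s)"
  have k: "0 < k" "k < 1" using rs by (auto simp: k_def)
  have "1 - k = 1 / (1 + r * s)" using rs by (simp add: k_def field_simps)
  then have "(1 - k) *\<^sub>R q + k *\<^sub>R w = (1 / (1 + r * s)) *\<^sub>R (q + (r * s) *\<^sub>R w)"
    by (simp add: k_def scaleR_add_right)
  also have "q + (r * s) *\<^sub>R w = (1 + r * s - r) *\<^sub>R v + r *\<^sub>R u"
    by (simp add: q_def algebra_simps)
  also have "(1 / (1 + r * s)) *\<^sub>R ((1 + r * s - r) *\<^sub>R v + r *\<^sub>R u)
      = (1 - r / (1 + r * s)) *\<^sub>R v + (r / (1 + r * s)) *\<^sub>R u"
    using rs by (simp add: scaleR_add_right diff_divide_distrib)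
  finally have eq: "(1 - k) *\<^sub>R q + k *\<^sub>R w
      = (1 - r / (1 + r * s)) *\<^sub>R v + (r / (1 + r * s)) *\<^sub>R u" .
  have "r / (1 + r * s) \<le> 1" using r rs by simp
  then have seg: "(1 - k) *\<^sub>R q + k *\<^sub>R w \<in> closed_segment v u"
    unfolding eq using r rs unfolding in_segment by (intro exI[of _ "r / (1 + r * s)"]) simp
  have "w \<in> closed_segment v u"
  proof (cases "q = w")
    case True
    then show ?thesis using seg by (simp flip: scaleR_add_left)
  next
    case False
    then have "(1 - k) *\<^sub>R q + k *\<^sub>R w \<in> open_segment q w"
      unfolding in_segment using k by blast
    then show ?thesis using edge seg mem(2) \<open>q \<in> P\<close> unfolding face_of_def by blast
  qed
  then have "w extreme_point_of closed_segment v u"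
    using extreme_point_of_face[OF edge] ver(1) by (simp add: vertices_def)
  then show False
    using ver(3) u(2) by (simp add: extreme_point_of_segment)
qed

end

section \<open>Dual coordinates at a vertex\<close>

text \<open>The values \<open>a w \<bullet> (p - v)\<close> will serve as coordinates of
  \<open>p\<close>, placing \<open>P\<close> inside a unit cube with \<open>v\<close> at the
  origin.\<close>

locale vertex_frame = antipodal_half_cover +
  fixes v :: 'a and N :: "'a set" and a :: "'a \<Rightarrow> 'a"
  assumes v: "v \<in> vertices P"
    and N: "N = neighbours v"
    and lower: "\<lbrakk>w \<in> N; p \<in> P\<rbrakk> \<Longrightarrow> 0 \<le> a w \<bullet> (p - v)"
    and upper: "\<lbrakk>w \<in> N; p \<in> P\<rbrakk> \<Longrightarrow> a w \<bullet> (p - v) \<le> 1"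
    and unit: "w \<in> N \<Longrightarrow> a w \<bullet> (w - v) = 1"
begin

lemma N_subset: "N \<subseteq> P" and finite_N: "finite N" and v_mem: "v \<in> P"
  using v vertices_subset finite_vertices[OF polytope]
  by (auto simp: N neighbours_def)

lemma biorthogonal:
  assumes "w \<in> N" "u \<in> N"
  shows "a w \<bullet> (u - v) = (if u = w then 1 else 0)"
  using inner_other_neighbour[OF v, of w u "a w"] assms lower upper unit N by auto

lemma inner_combination:
  assumes "w \<in> N" "M \<subseteq> N"
  shows "a w \<bullet> (\<Sum>u\<in>M. c u *\<^sub>R (u - v)) = (if w \<in> M then c w else 0)"
proof -
  have "a w \<bullet> (\<Sum>u\<in>M. c u *\<^sub>R (u - v)) = (\<Sum>u\<in>M. c u * (a w \<bullet> (u - v)))"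
    by (simp add: inner_sum_right)
  also have "\<dots> = (\<Sum>u\<in>M. if u = w then c u else 0)"
    using assms by (intro sum.cong) (auto simp: biorthogonal subset_iff)
  finally show ?thesis
    using finite_subset[OF assms(2) finite_N] by simp
qed

text \<open>The projections are made one edge at a time. By biorthogonality the earlier ones do not
  change the later coordinates.\<close>

lemma feasible_project_all:
  assumes "feasible v d" "M \<subseteq> N"
  shows "feasible v (d - (\<Sum>w\<in>M. (a w \<bullet> d) *\<^sub>R (w - v)))"
  using finite_subset[OF assms(2) finite_N] assms(2)
proof (induction M rule: finite_induct)
  case empty
  then show ?case using assms(1) by simp
next
  case (insert w M)
  define e where "e = d - (\<Sum>w\<in>M. (a w \<bullet> d) *\<^sub>R (w - v))"
  have "feasible v e" using insert by (simp add: e_def)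
  moreover have "a w \<bullet> e = a w \<bullet> d"
    using insert inner_combination[of w M "\<lambda>w. a w \<bullet> d"]
    by (simp add: e_def inner_diff_right[of "a w" d])
  ultimately have "feasible v (e - (a w \<bullet> d) *\<^sub>R (w - v))"
    using feasible_project[OF v, of w "a w" e] insert.prems upper unit N by auto
  then show ?case using insert by (simp add: e_def algebra_simps)
qed

lemma expand:
  assumes "p \<in> P"
  shows "p - v = (\<Sum>w\<in>N. (a w \<bullet> (p - v)) *\<^sub>R (w - v))"
proof (rule ccontr)
  define e where "e = p - v - (\<Sum>w\<in>N. (a w \<bullet> (p - v)) *\<^sub>R (w - v))"
  assume "\<not> ?thesis"
  then have "e \<noteq> 0" by (simp add: e_def)
  have "feasible v (p - v)"
    unfolding feasible_def using assms by (intro exI[of _ 1]) simp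
  then have "feasible v e"
    unfolding e_def by (rule feasible_project_all) simp
  then obtain t where t: "t > 0" "v + t *\<^sub>R e \<in> P" by (auto simp: feasible_def)
  have ae: "a w \<bullet> e = 0" if "w \<in> N" for w
    using inner_combination[OF that, of N "\<lambda>w. a w \<bullet> (p - v)"] that
    by (simp add: e_def inner_diff_right[of "a w" "p - v"])
  \<comment> \<open>A remainder \<open>e\<close> annihilated by all functionals would span a face at \<open>v\<close> with a further edge.\<close>
  define F where "F = \<Inter> (insert P ((\<lambda>w. P \<inter> {x. a w \<bullet> x = a w \<bullet> v}) ` N))"
  have F: "F face_of P"
    unfolding F_def
  proof (rule face_of_Inter)
    fix T assume "T \<in> insert P ((\<lambda>w. P \<inter> {x. a w \<bullet> x = a w \<bullet> v}) ` N)"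
    then show "T face_of P"
      using lower
      by (auto intro!: face_of_refl convex face_of_Int_supporting_hyperplane_ge
          simp: inner_diff_right)
  qed simp
  have F_iff: "x \<in> F \<longleftrightarrow> x \<in> P \<and> (\<forall>w\<in>N. a w \<bullet> (x - v) = 0)" for x
    by (auto simp: F_def inner_diff_right)
  have "v extreme_point_of F"
    using v v_mem extreme_point_of_face[OF F] by (simp add: vertices_def F_iff)
  moreover have "v + t *\<^sub>R e \<in> F" using t ae by (simp add: F_iff)
  then have "F \<noteq> {v}" using \<open>e \<noteq> 0\<close> t by auto
  moreover have "polytope F" using F polytope face_of_polytope_polytope by blast
  ultimately obtain u where u: "u \<noteq> v" "u extreme_point_of F" "closed_segment v u face_of F"
    using edge_at_extreme_point by blast
  then have "u \<in> N" "u \<in> F"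
    using F extreme_point_of_face[OF F] face_of_trans
    by (auto simp: N neighbours_def vertices_def)
  \<comment> \<open>As a neighbour of \<open>v\<close>, \<open>u\<close> has its own coordinate
    equal to 1, whereas all coordinates vanish on \<open>F\<close>.\<close>
  then show False using unit[of u] by (simp add: F_iff)
qed

text \<open>Biorthogonality makes the edge vectors independent. They span because every vector is a
  multiple of a difference of two points of \<open>P\<close>, taken in a ball inside
  \<open>P\<close>.\<close>

lemma card_N: "card N = DIM('a)"
proof -
  have inj: "inj_on (\<lambda>w. w - v) N" by (simp add: inj_on_def)
  have "independent ((\<lambda>w. w - v) ` N)"
  proof (rule independent_if_scalars_zero)
    show "finite ((\<lambda>w. w - v) ` N)" using finite_N by simp
    fix f x assume eq: "(\<Sum>x\<in>(\<lambda>w. w - v) ` N. f x *\<^sub>R x) = 0" and "x \<in> (\<lambda>w. w - v) ` N"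
    then obtain w where w: "w \<in> N" "x = w - v" by blast
    have "(\<Sum>u\<in>N. f (u - v) *\<^sub>R (u - v)) = 0"
      using eq by (simp add: sum.reindex[OF inj] o_def)
    then show "f x = 0"
      using inner_combination[OF w(1), of N "\<lambda>u. f (u - v)"] w by simp
  qed
  moreover have "UNIV \<subseteq> span ((\<lambda>w. w - v) ` N)"
  proof
    fix x :: 'a
    have P: "p - v \<in> span ((\<lambda>w. w - v) ` N)" if "p \<in> P" for p
      by (subst expand[OF that]) (intro span_sum span_scale span_base imageI)
    obtain z e where z: "e > 0" "cball z e \<subseteq> P"
      using interior mem_interior_cball by (metis all_not_in_conv)
    define k where "k = e / (norm x + 1)"
    have nx: "norm x + 1 > 0" using norm_ge_zero[of x] by linarith
    have "k > 0" using z(1) nx by (simp add: k_def)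
    have "k * norm x \<le> k * (norm x + 1)" using \<open>k > 0\<close> by simp
    also have "\<dots> = e" using nx by (simp add: k_def)
    finally have "z + k *\<^sub>R x \<in> P" "z \<in> P"
      using z \<open>k > 0\<close> by (auto simp: dist_norm subset_iff)
    then have "(z + k *\<^sub>R x - v) - (z - v) \<in> span ((\<lambda>w. w - v) ` N)"
      by (intro span_diff P)
    then have "k *\<^sub>R x \<in> span ((\<lambda>w. w - v) ` N)" by simp
    then have "(1 / k) *\<^sub>R (k *\<^sub>R x) \<in> span ((\<lambda>w. w - v) ` N)" by (rule span_scale)
    moreover have "(1 / k) *\<^sub>R (k *\<^sub>R x) = x" using \<open>k > 0\<close> by simp
    ultimately show "x \<in> span ((\<lambda>w. w - v) ` N)" by metis
  qed
  ultimately have "card ((\<lambda>w. w - v) ` N) = dim (UNIV :: 'a set)"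
    by (intro basis_card_eq_dim) auto
  then show ?thesis by (simp add: card_image[OF inj])
qed

section \<open>Corners of the parallelepiped\<close>

text \<open>Coordinates of points of \<open>P\<close> lie between 0 and 1, so a proper convex
  combination reaches either bound only if both end points do.\<close>

lemma coordinate_face:
  assumes "M \<subseteq> N" and c: "\<And>u. u \<in> M \<Longrightarrow> c u = 0 \<or> c u = (1::real)"
  shows "{x \<in> P. \<forall>u\<in>M. a u \<bullet> (x - v) = c u} face_of P"
  unfolding face_of_def
proof (intro conjI ballI impI)
  have "{x \<in> P. \<forall>u\<in>M. a u \<bullet> (x - v) = c u} = P \<inter> (\<Inter>u\<in>M. {x. a u \<bullet> x = c u + a u \<bullet> v})"
    by (auto simp: inner_diff_right algebra_simps)
  also have "convex \<dots>"
    by (intro convex_Int convex convex_INT convex_hyperplane)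
  finally show "convex {x \<in> P. \<forall>u\<in>M. a u \<bullet> (x - v) = c u}" .
next
  fix x y z assume xy: "x \<in> P" "y \<in> P" and z: "z \<in> {x \<in> P. \<forall>u\<in>M. a u \<bullet> (x - v) = c u}"
    and seg: "z \<in> open_segment x y"
  obtain t where t: "0 < t" "t < 1" "z = (1 - t) *\<^sub>R x + t *\<^sub>R y"
    using seg by (auto simp: in_segment)
  have "a u \<bullet> (x - v) = c u \<and> a u \<bullet> (y - v) = c u" if "u \<in> M" for u
  proof -
    define X Y where "X = a u \<bullet> (x - v)" and "Y = a u \<bullet> (y - v)"
    have XY: "0 \<le> X" "X \<le> 1" "0 \<le> Y" "Y \<le> 1"
      using lower upper xy that assms(1) by (auto simp: X_def Y_def)
    have "z - v = (1 - t) *\<^sub>R (x - v) + t *\<^sub>R (y - v)"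
      by (simp add: t(3) algebra_simps)
    then have eq: "(1 - t) * X + t * Y = c u"
      using z that by (simp add: X_def Y_def inner_add_right)
    from c[OF that] show ?thesis
    proof
      assume "c u = 0"
      then have "(1 - t) * X = 0 \<and> t * Y = 0"
        using eq t XY by (simp add: add_nonneg_eq_0_iff)
      then show ?thesis using t \<open>c u = 0\<close> by (simp add: X_def Y_def)
    next
      assume "c u = 1"
      then have "(1 - t) * (1 - X) + t * (1 - Y) = 0" using eq by (simp add: algebra_simps)
      then have "(1 - t) * (1 - X) = 0 \<and> t * (1 - Y) = 0"
        using t XY by (subst (asm) add_nonneg_eq_0_iff) auto
      then show ?thesis using t \<open>c u = 1\<close> by (simp add: X_def Y_def)
    qed
  qed
  then show "x \<in> {x \<in> P. \<forall>u\<in>M. a u \<bullet> (x - v) = c u}" "y \<in> {x \<in> P. \<forall>u\<in>M. a u \<bullet> (x - v) = c u}"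
    using xy by auto
qed auto

text \<open>The second conjunct strengthens the induction: the edge directions of the parallelepiped
  remain feasible at each corner reached, so the walk can continue.\<close>

lemma corner_in_P:
  assumes "S \<subseteq> N"
  shows "v + (\<Sum>u\<in>S. u - v) \<in> P
    \<and> (\<forall>u\<in>N. feasible (v + (\<Sum>u\<in>S. u - v)) (if u \<in> S then v - u else u - v))"
  using finite_subset[OF assms finite_N] assms
proof (induction S rule: finite_induct)
  case empty
  have "feasible v (u - v)" if "u \<in> N" for u
    using N_subset that unfolding feasible_def by (intro exI[of _ 1]) auto
  then show ?case using v_mem by simp
next
  case (insert i S)
  define c where "c = v + (\<Sum>u\<in>S. u - v)"
  \<comment> \<open>The direction from \<open>c\<close> into the parallelepiped: coordinate
    \<open>u\<close> falls if it is 1 at \<open>c\<close> and rises if it is 0.\<close>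
  define b where "b u = (if u \<in> S then v - u else u - v)" for u
  have i: "i \<in> N" "i \<notin> S" and S: "S \<subseteq> N" "finite S" using insert by auto
  have cP: "c \<in> P" and feas: "\<And>u. u \<in> N \<Longrightarrow> feasible c (b u)"
    using insert.IH S unfolding c_def b_def by auto
  have ac: "a u \<bullet> (c - v) = (if u \<in> S then 1 else 0)" if "u \<in> N" for u
    using inner_combination[OF that S(1), of "\<lambda>_. 1"] by (simp add: c_def)
  have ab: "a i \<bullet> b u = 0" if "u \<in> N" "u \<noteq> i" for u
    using biorthogonal[OF i(1) that(1)] that(2) i(2)
    by (auto simp: b_def inner_diff_right)
  have expand_c: "x - c = (\<Sum>u\<in>N. (a u \<bullet> (x - c)) *\<^sub>R (u - v))" if "x \<in> P" for x
  proof -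
    have "x - c = (x - v) - (c - v)" by simp
    also have "\<dots> = (\<Sum>u\<in>N. (a u \<bullet> (x - v)) *\<^sub>R (u - v)) - (\<Sum>u\<in>N. (a u \<bullet> (c - v)) *\<^sub>R (u - v))"
      using expand[OF that] expand[OF cP] by simp
    also have "\<dots> = (\<Sum>u\<in>N. (a u \<bullet> (x - c)) *\<^sub>R (u - v))"
      by (simp add: sum_subtractf[symmetric] scaleR_diff_left[symmetric] inner_diff_right)
    finally show ?thesis .
  qed
  \<comment> \<open>\<open>c\<close> is the only point of \<open>P\<close> with its coordinates, and
    these are all 0 or 1.\<close>
  have c_ext: "c extreme_point_of P"
  proof -
    have "{x \<in> P. \<forall>u\<in>N. a u \<bullet> (x - v) = a u \<bullet> (c - v)} = {c}"
    proof (intro subset_antisym subsetI)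
      fix x assume "x \<in> {x \<in> P. \<forall>u\<in>N. a u \<bullet> (x - v) = a u \<bullet> (c - v)}"
      then have x: "x \<in> P" "\<And>u. u \<in> N \<Longrightarrow> a u \<bullet> (x - c) = 0"
        by (auto simp: inner_diff_right)
      have "x - c = 0" by (subst expand_c[OF x(1)]) (simp add: x(2))
      then show "x \<in> {c}" by simp
    qed (use cP in auto)
    then have "{c} face_of P"
      using coordinate_face[of N "\<lambda>u. a u \<bullet> (c - v)"] ac by auto
    then show ?thesis by (simp add: face_of_singleton)
  qed
  \<comment> \<open>The next edge of the walk is the face of \<open>P\<close> on the line through \<open>c\<close> in direction \<open>i - v\<close>. It
    has full length \<open>s = 1\<close>, since the functional \<open>h\<close> of that edge turns out to be the \<open>i\<close>-th
    coordinate divided by \<open>s\<close>, and it is at most 1 at the vertex \<open>i\<close> of \<open>P\<close>.\<close>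
  define E where "E = {x \<in> P. \<forall>u\<in>N-{i}. a u \<bullet> (x - v) = a u \<bullet> (c - v)}"
  have E: "E face_of P"
    unfolding E_def by (rule coordinate_face) (auto simp: ac)
  have E_line: "x = c + (a i \<bullet> (x - v)) *\<^sub>R (i - v)" if "x \<in> E" for x
  proof -
    have "a u \<bullet> (x - c) = (if u = i then a i \<bullet> (x - v) else 0)" if "u \<in> N" for u
      using \<open>x \<in> E\<close> that ac[OF i(1)] i(2) by (auto simp: E_def inner_diff_right)
    then have "x - c = (\<Sum>u\<in>N. if u = i then (a i \<bullet> (x - v)) *\<^sub>R (i - v) else 0)"
      using \<open>x \<in> E\<close> by (subst expand_c) (auto simp: E_def intro!: sum.cong)
    then have "x - c = (a i \<bullet> (x - v)) *\<^sub>R (i - v)"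
      using finite_N i(1) by simp
    then show ?thesis by (simp add: algebra_simps)
  qed
  have "c extreme_point_of E"
    using c_ext cP extreme_point_of_face[OF E] by (simp add: E_def)
  moreover have "E \<noteq> {c}"
  proof -
    obtain t where t: "t > 0" "c + t *\<^sub>R (i - v) \<in> P"
      using feas[OF i(1)] i(2) by (auto simp: feasible_def b_def)
    have "a u \<bullet> (c + t *\<^sub>R (i - v) - v) = a u \<bullet> (c - v)" if "u \<in> N - {i}" for u
    proof -
      have "c + t *\<^sub>R (i - v) - v = (c - v) + t *\<^sub>R (i - v)" by simp
      then show ?thesis
        using biorthogonal[of u i] that i(1) by (simp only: inner_add_right) auto
    qed
    then have "c + t *\<^sub>R (i - v) \<in> E" using t by (simp add: E_def)
    moreover have "i \<noteq> v" using unit[OF i(1)] by auto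
    ultimately show ?thesis using t(1) by auto
  qed
  moreover have "polytope E" using E polytope face_of_polytope_polytope by blast
  ultimately obtain w where w: "w \<noteq> c" "w extreme_point_of E" "closed_segment c w face_of E"
    using edge_at_extreme_point by blast
  have wE: "w \<in> E" and wP: "w \<in> P" and w_ver: "w \<in> vertices P"
    using w(2) extreme_point_of_face[OF E] by (auto simp: vertices_def extreme_point_of_def)
  have c_ver: "c \<in> vertices P" using c_ext by (simp add: vertices_def)
  have edge: "closed_segment c w face_of P" using w(3) E face_of_trans by blast
  then have w_nb: "w \<in> neighbours c" using w(1) w_ver by (simp add: neighbours_def)
  define s where "s = a i \<bullet> (w - v)"
  have wc: "w - c = s *\<^sub>R (i - v)" using E_line[OF wE] by (simp add: s_def algebra_simps)
  have "0 \<le> s" "s \<le> 1" using lower upper i(1) wP by (auto simp: s_def)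
  moreover have "s \<noteq> 0" using wc w(1) by auto
  ultimately have s: "0 < s" "s \<le> 1" by auto
  obtain h where h: "\<And>p. p \<in> P \<Longrightarrow> 0 \<le> h \<bullet> (p - c)" "\<And>p. p \<in> P \<Longrightarrow> h \<bullet> (p - c) \<le> 1"
    "h \<bullet> (w - c) = 1"
    using separating_functional[OF c_ver w_ver] w(1) by metis
  \<comment> \<open>Nonnegative because \<open>h\<close> is minimal at \<open>c\<close> and
    \<open>b u\<close> is feasible there. If it were positive, projecting \<open>b u\<close> along
    the edge would make coordinate \<open>i\<close>, which is 0 at \<open>c\<close>,
    negative.\<close>
  have hb: "h \<bullet> b u = 0" if u: "u \<in> N" "u \<noteq> i" for u
  proof (rule antisym)
    obtain t where "t > 0" "c + t *\<^sub>R b u \<in> P" using feas[OF u(1)] by (auto simp: feasible_def)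
    then show "0 \<le> h \<bullet> b u" using h(1)[of "c + t *\<^sub>R b u"] by (simp add: zero_le_mult_iff)
    have "feasible c (b u - (h \<bullet> b u) *\<^sub>R (w - c))"
      using feasible_project[OF c_ver w_nb h(2,3) feas[OF u(1)]] by simp
    then obtain t where t: "t > 0" "c + t *\<^sub>R (b u - (h \<bullet> b u) *\<^sub>R (w - c)) \<in> P"
      by (auto simp: feasible_def)
    have "0 \<le> a i \<bullet> ((c - v) + t *\<^sub>R (b u - (h \<bullet> b u) *\<^sub>R (s *\<^sub>R (i - v))))"
      using lower[OF i(1) t(2)] by (simp add: wc algebra_simps)
    also have "\<dots> = - (t * ((h \<bullet> b u) * s))"
      using ac[OF i(1)] i(2) ab[OF u] unit[OF i(1)]
      by (simp add: inner_add_right inner_diff_right[of _ "b u"])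
    finally show "h \<bullet> b u \<le> 0"
      using t(1) s(1) by (simp add: mult_le_0_iff)
  qed
  have hi: "h \<bullet> (i - v) = 1 / s"
  proof -
    have "s * (h \<bullet> (i - v)) = 1" using h(3) unfolding wc by (simp only: inner_scaleR_right)
    then show ?thesis using s(1) by (simp add: eq_divide_eq mult.commute)
  qed
  have "s = 1"
  proof -
    have hu: "h \<bullet> (u - v) = 0" if "u \<in> N" "u \<noteq> i" for u
      using hb[OF that] by (auto simp: b_def inner_diff_right split: if_splits)
    have iP: "i \<in> P" using i(1) N_subset by blast
    have "h \<bullet> (i - c) = (\<Sum>u\<in>N. (a u \<bullet> (i - c)) * (h \<bullet> (u - v)))"
      by (subst expand_c[OF iP]) (simp add: inner_sum_right)
    also have "\<dots> = (\<Sum>u\<in>N. if u = i then (a i \<bullet> (i - c)) / s else 0)"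
      by (intro sum.cong) (auto simp: hu hi)
    also have "\<dots> = (a i \<bullet> (i - c)) / s" using finite_N i(1) by simp
    also have "a i \<bullet> (i - c) = 1"
      using unit[OF i(1)] ac[OF i(1)] i(2) by (simp add: inner_diff_right)
    finally have "1 / s \<le> 1" using h(2)[OF iP] by simp
    then show ?thesis using s by (simp add: divide_le_eq)
  qed
  then have w_eq: "w = c + (i - v)" using wc by (simp add: algebra_simps)
  \<comment> \<open>The direction passes from \<open>c\<close> to the midpoint and on to
    \<open>w\<close>, with the ends of the edge exchanged and \<open>- h\<close> as functional; this
    works because \<open>h\<close> vanishes on \<open>b u\<close>.\<close>
  have feas_w: "feasible w (b u)" if u: "u \<in> N" "u \<noteq> i" for u
  proof (rule feasible_from_midpoint[OF w_ver c_ver w(1), of "- h"])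
    show "closed_segment w c face_of P" using edge by (simp add: closed_segment_commute)
    show "- h \<bullet> p \<le> - h \<bullet> c" if "p \<in> P" for p
      using h(1)[OF that] by (simp add: inner_diff_right)
    show "- h \<bullet> w < - h \<bullet> c" using h(3) by (simp add: inner_diff_right)
    show "feasible ((1/2) *\<^sub>R (w + c)) (b u)"
      using feasible_midpoint[OF cP wP feas[OF u(1)], of 0] by (simp add: add.commute)
    show "0 \<le> - h \<bullet> b u" using hb[OF u] by simp
  qed
  have feas_i: "feasible w (v - i)"
    unfolding feasible_def using cP w_eq by (intro exI[of _ 1]) simp
  have corner: "v + (\<Sum>u\<in>insert i S. u - v) = w"
    using S i by (simp add: w_eq c_def algebra_simps)
  have "feasible w (if u \<in> insert i S then v - u else u - v)" if "u \<in> N" for u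
    using feas_w[OF that] feas_i by (cases "u = i") (simp_all add: b_def)
  then show ?case unfolding corner using wP by blast
qed

end

section \<open>Identification with the cube and conclusion\<close>

lemma (in antipodal_half_cover) obtain_vertex_frame:
  obtains v N a where "vertex_frame P v N a"
proof -
  have "P \<noteq> {}" using interior by auto
  then obtain v where v: "v \<in> vertices P"
    using extreme_point_exists_convex[of P] polytope polytope_imp_compact convex
    by (auto simp: vertices_def)
  have "\<exists>a. (\<forall>p\<in>P. 0 \<le> a \<bullet> (p - v) \<and> a \<bullet> (p - v) \<le> 1) \<and> a \<bullet> (w - v) = 1"
    if w: "w \<in> neighbours v" for w
  proof -
    have "w \<in> vertices P" "v \<noteq> w" using w by (auto simp: neighbours_def)
    from separating_functional[OF v this] show ?thesis by metis
  qed
  then obtain a where a: "\<And>w. w \<in> neighbours v \<Longrightarrow>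
      (\<forall>p\<in>P. 0 \<le> a w \<bullet> (p - v) \<and> a w \<bullet> (p - v) \<le> 1) \<and> a w \<bullet> (w - v) = 1"
    by metis
  have "vertex_frame P v (neighbours v) a"
    by unfold_locales (use v a in auto)
  then show ?thesis by (rule that)
qed

text \<open>The expansion in dual coordinates puts \<open>P\<close> inside the image of the cube.
  Conversely, the cube is the hull of the 0/1 vectors, whose images are corners in
  \<open>P\<close>.\<close>

lemma parallelepiped_if_antipodal_half_cover:
  fixes P :: "(real ^ 'n) set"
  assumes "antipodal_half_cover P"
  shows "\<exists>(f :: real ^ 'n \<Rightarrow> real ^ 'n) c. linear f \<and> P = (\<lambda>x. c + f x) ` cbox 0 1"
proof -
  interpret antipodal_half_cover P by fact
  obtain v N a where "vertex_frame P v N a" by (rule obtain_vertex_frame)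
  then interpret vertex_frame P v N a .
  have "card N = card (UNIV :: 'n set)" using card_N by simp
  then obtain \<sigma> :: "'n \<Rightarrow> real ^ 'n" where \<sigma>: "bij_betw \<sigma> UNIV N"
    using finite_same_card_bij[of "UNIV :: 'n set" N] finite_N by auto
  then have inj: "inj \<sigma>" and range: "range \<sigma> = N" by (auto simp: bij_betw_def)
  define f :: "real ^ 'n \<Rightarrow> real ^ 'n" where "f x = (\<Sum>i\<in>UNIV. (x $ i) *\<^sub>R (\<sigma> i - v))" for x
  have "linear f"
    unfolding f_def
    by (intro linearI)
      (simp_all add: scaleR_add_left sum.distrib scaleR_sum_right)
  have "(\<lambda>x. v + f x) ` cbox 0 1 = P"
  proof (intro subset_antisym subsetI)
    fix p assume p: "p \<in> P"
    define x :: "real ^ 'n" where "x = (\<chi> i. a (\<sigma> i) \<bullet> (p - v))"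
    have "p - v = (\<Sum>w\<in>N. (a w \<bullet> (p - v)) *\<^sub>R (w - v))" by (rule expand[OF p])
    also have "\<dots> = f x"
      unfolding f_def x_def range[symmetric] using inj by (simp add: sum.reindex)
    finally have "p = v + f x" by (simp add: algebra_simps)
    moreover have "x \<in> cbox 0 1"
      using lower upper p range by (auto simp: mem_box_cart x_def)
    ultimately show "p \<in> (\<lambda>x. v + f x) ` cbox 0 1" by blast
  next
    \<comment> \<open>\<open>P\<close> is translated by \<open>- v\<close> so that the hull can be
      moved through the linear map \<open>f\<close> alone.\<close>
    have corner: "f x \<in> (+) (- v) ` P" if x: "\<forall>i. x $ i = 0 \<or> x $ i = 1" for x
    proof -
      define S where "S = {i. x $ i = 1}"
      have "f x = (\<Sum>i\<in>UNIV. if i \<in> S then \<sigma> i - v else 0)"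
        unfolding f_def by (intro sum.cong) (use x in \<open>auto simp: S_def\<close>)
      also have "\<dots> = (\<Sum>i\<in>S. \<sigma> i - v)" by (simp add: sum.If_cases)
      also have "\<dots> = (\<Sum>u\<in>\<sigma> ` S. u - v)"
        using inj by (simp add: sum.reindex inj_on_subset)
      finally have "v + f x \<in> P" using corner_in_P[of "\<sigma> ` S"] range by auto
      then show ?thesis by (intro image_eqI[of _ _ "v + f x"]) auto
    qed
    have "(1 :: real ^ 'n) = \<Sum>Basis"
      by (rule Cart_1)
    then have cube: "cbox 0 (1 :: real ^ 'n) = convex hull {x. \<forall>i. x $ i = 0 \<or> x $ i = 1}"
      using unit_interval_convex_hull[where 'a = "real ^ 'n"]
      by (simp add: Basis_vec_def inner_axis)
    have "f ` cbox 0 1 = convex hull (f ` {x. \<forall>i. x $ i = 0 \<or> x $ i = 1})"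
      unfolding cube
      by (rule convex_hull_linear_image[OF \<open>linear f\<close>])
    also have "\<dots> \<subseteq> (+) (- v) ` P"
      by (intro hull_minimal convex_translation convex) (use corner in auto)
    finally show "q \<in> P" if "q \<in> (\<lambda>x. v + f x) ` cbox 0 1" for q
      using that by (auto simp: subset_iff image_iff)
  qed
  then show ?thesis using \<open>linear f\<close> by blast
qed

theorem lemma2p1:
  "(\<forall>(l::real) (P::(real ^ 'n) set).
      1 / (real CARD('n) + 1) \<le> l \<and> l \<le> 1 / 2 \<and> P \<in> VG l \<and> interior P \<noteq> {}
      \<longrightarrow> real (card (vertices P)) \<ge> 1 / (1 - l) ^ CARD('n)) \<and>
   (\<forall>P::(real ^ 'n) set.
      P \<in> VG (1 / 2) \<and> interior P \<noteq> {} \<and> card (vertices P) = 2 ^ CARD('n)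
      \<longrightarrow> (\<exists>(f :: real ^ 'n \<Rightarrow> real ^ 'n) c. linear f \<and> P = (\<lambda>x. c + f x) ` cbox 0 1))"
proof (intro conjI allI impI)
  fix l :: real and P :: "(real ^ 'n) set"
  assume "1 / (real CARD('n) + 1) \<le> l \<and> l \<le> 1 / 2 \<and> P \<in> VG l \<and> interior P \<noteq> {}"
  then have l: "l < 1" and P: "P \<in> VG l" "interior P \<noteq> {}" by auto
  have "polytope P" using P by (simp add: VG_def)
  then show "1 / (1 - l) ^ CARD('n) \<le> real (card (vertices P))"
    using card_cover_ge[OF polytope_imp_compact P(2) finite_vertices l VG_cover[OF P(1) l P(2)]]
    by simp
next
  fix P :: "(real ^ 'n) set"
  assume "P \<in> VG (1 / 2) \<and> interior P \<noteq> {} \<and> card (vertices P) = 2 ^ CARD('n)"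
  then have P: "P \<in> VG (1 / 2)" "interior P \<noteq> {}" "card (vertices P) = 2 ^ DIM(real ^ 'n)"
    by auto
  have poly: "polytope P" using P by (simp add: VG_def)
  have cover: "P \<subseteq> (\<Union>v\<in>vertices P. (\<lambda>p. (1/2) *\<^sub>R p + (1/2) *\<^sub>R v) ` P)"
    using VG_cover[OF P(1) _ P(2)] by simp
  have "antipodal_half_cover P"
  proof
    show "\<exists>v\<in>vertices P. 2 *\<^sub>R x - v \<in> P" if x: "x \<in> P" for x
    proof -
      obtain v p where "v \<in> vertices P" "p \<in> P" "x = (1/2) *\<^sub>R p + (1/2) *\<^sub>R v"
        using cover x by blast
      then show ?thesis by (intro bexI[of _ v]) (auto simp: scaleR_add_right)
    qed
    show "\<exists>a. a \<noteq> 0 \<and> (\<forall>p\<in>P. a \<bullet> v \<le> a \<bullet> p \<and> a \<bullet> p \<le> a \<bullet> w)"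
      if "v \<in> vertices P" "w \<in> vertices P" "v \<noteq> w" for v w
      using antipodal_if_tight_half_cover[OF polytope_imp_compact[OF poly]
          polytope_imp_convex[OF poly] P(2) vertices_subset P(3) cover that] by metis
  qed (use poly P in auto)
  then show "\<exists>(f :: real ^ 'n \<Rightarrow> real ^ 'n) c. linear f \<and> P = (\<lambda>x. c + f x) ` cbox 0 1"
    by (rule parallelepiped_if_antipodal_half_cover)
qed

end
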